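(* Let $f\in C^1([-1,1])$ be real-valued, and let $q$ be a (continuous, complex-valued) function on $\mathbb{T}^n$ with Fourier coefficients $\hat q(k)\in\mathbb{R}$ for all $k\in\mathbb{Z}^n$. If $\|q\|_{C^0(\mathbb{T}^n)}$ is small enough, then $$\big(f(|q|^2)\big)^{\wedge}(k)\in\mathbb{R}\qquad\text{for all }k\in\mathbb{Z}^n .$$
   Context: $\hat g(k)=g^{\wedge}(k)$ denotes the $k$-th Fourier coefficient of a function $g$ on the torus $\mathbb{T}^n$, and $\|\cdot\|_{C^0(\mathbb{T}^n)}$ is the sup norm. "Small enough" means smaller than a suitable absolute constant (in particular $|q|^2$ takes values well inside $[-1,1]$). *)

theory Defs
  imports "HOL-Analysis.Analysis"
begin

text \<open>Derivatives are taken within \<open>S\<close>, hence one-sided at the endpoints of a closed interval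
  (the library's \<open>C1_differentiable_on\<close> would require two-sided derivatives there).\<close>

definition C1_on :: "real set \<Rightarrow> (real \<Rightarrow> real) \<Rightarrow> bool" where
  "C1_on S f \<longleftrightarrow>
     (\<exists>f'. (\<forall>x\<in>S. (f has_real_derivative f' x) (at x within S)) \<and> continuous_on S f')"

text \<open>The dimension \<open>n\<close> is a term, so that constants can be chosen uniformly in it: points of
  $\mathbb{R}^n$ and $\mathbb{Z}^n$ are the elements of \<open>{..<n} \<rightarrow>\<^sub>E UNIV\<close>. Functions on the torus
  $\mathbb{T}^n = (\mathbb{R}/2\pi\mathbb{Z})^n$ are functions on $\mathbb{R}^n$ that are
  \<open>2 * pi\<close>-periodic in each coordinate.\<close>

definition torus_fun :: "nat \<Rightarrow> ((nat \<Rightarrow> real) \<Rightarrow> complex) \<Rightarrow> bool" where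
  "torus_fun n g \<longleftrightarrow>
     (\<forall>x \<in> {..<n} \<rightarrow>\<^sub>E UNIV. \<forall>i<n. g (x(i := x i + 2 * pi)) = g x)"

definition torus_continuous :: "nat \<Rightarrow> ((nat \<Rightarrow> real) \<Rightarrow> complex) \<Rightarrow> bool" where
  "torus_continuous n g \<longleftrightarrow>
     torus_fun n g \<and> continuous_map (product_topology (\<lambda>_. euclideanreal) {..<n}) euclidean g"

definition torus_sup_norm :: "nat \<Rightarrow> ((nat \<Rightarrow> real) \<Rightarrow> complex) \<Rightarrow> real" where
  "torus_sup_norm n g = (SUP x \<in> {..<n} \<rightarrow>\<^sub>E UNIV. norm (g x))"

definition fourier_coeff :: "nat \<Rightarrow> ((nat \<Rightarrow> real) \<Rightarrow> complex) \<Rightarrow> (nat \<Rightarrow> int) \<Rightarrow> complex" where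
  "fourier_coeff n g k =
     (LINT x : {..<n} \<rightarrow>\<^sub>E {0..2 * pi} | (\<Pi>\<^sub>M i\<in>{..<n}. lborel).
        g x * cis (- (\<Sum>i<n. of_int (k i) * x i))) / of_real ((2 * pi) ^ n)"

end

theory Submission imports Defs begin

text \<open>The Fourier coefficients of \<open>x \<mapsto> cnj (q (- x))\<close> are the conjugates of those of \<open>q\<close>. If these
  are real, uniqueness of Fourier coefficients gives \<open>cnj (q (- x)) = q x\<close>, so \<open>norm (q x)\<close> and hence
  \<open>f ((norm (q x))\<^sup>2)\<close> are even in \<open>x\<close>; a real even function has real Fourier coefficients.

  Uniqueness: if all Fourier coefficients of a continuous \<open>g\<close> vanish, then \<open>g\<close> is orthogonal to all
  powers of the trigonometric polynomial \<open>\<Prod>i<n. (1 + cos (x i - y i)) / 2\<close>, which concentrate at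
  \<open>y\<close>, so that \<open>g y = 0\<close>. Taking \<open>y\<close> in the interior of the fundamental box \<open>[0, 2 * pi]^n\<close>, where the
  kernel has its only peak, avoids translating the box; boundary points follow by continuity.\<close>

section \<open>Characters on the fundamental box\<close>

abbreviation torus_measure :: "nat \<Rightarrow> (nat \<Rightarrow> real) measure" where
  "torus_measure n \<equiv> \<Pi>\<^sub>M i\<in>{..<n}. lborel"

abbreviation torus_box :: "nat \<Rightarrow> (nat \<Rightarrow> real) set" where
  "torus_box n \<equiv> {..<n} \<rightarrow>\<^sub>E {0..2 * pi}"

definition torus_char :: "nat \<Rightarrow> (nat \<Rightarrow> int) \<Rightarrow> (nat \<Rightarrow> real) \<Rightarrow> complex" where
  "torus_char n k x = cis (- (\<Sum>i<n. of_int (k i) * x i))"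

text \<open>This is \<open>x \<mapsto> - x\<close> on the torus, in the representative that preserves \<open>torus_box n\<close>.\<close>

definition torus_reflect :: "nat \<Rightarrow> (nat \<Rightarrow> real) \<Rightarrow> nat \<Rightarrow> real" where
  "torus_reflect n x = (\<lambda>i\<in>{..<n}. 2 * pi - x i)"

lemma product_sigma_finite_lborel: "product_sigma_finite (\<lambda>i::nat. lborel :: real measure)"
  by standard

lemma torus_box_sets [measurable]: "torus_box n \<in> sets (torus_measure n)"
  by (intro sets_PiM_I_finite) auto

lemma emeasure_torus_box_finite: "emeasure (torus_measure n) (torus_box n) < \<infinity>"
proof -
  interpret product_sigma_finite "\<lambda>i::nat. lborel :: real measure"
    by (rule product_sigma_finite_lborel)
  show ?thesis
    by (subst emeasure_PiM) (auto simp: ennreal_power[symmetric] power_less_top_ennreal)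
qed

lemma torus_char_measurable [measurable]: "torus_char n k \<in> borel_measurable (torus_measure n)"
  unfolding torus_char_def cis_conv_exp by measurable

lemma norm_torus_char [simp]: "norm (torus_char n k x) = 1"
  by (simp add: torus_char_def)

text \<open>Only the \<open>i\<close>-th summand of the phase changes. Hence multiplying by an
  exponential in one coordinate moves one Fourier coefficient to a neighbouring one, which is how
  cosine factors are absorbed later.\<close>

lemma torus_char_shift:
  assumes "i < n"
  shows "torus_char n (k(i := k i + m)) x = torus_char n k x * cis (- (of_int m * x i))"
proof -
  have "(\<Sum>j<n. of_int ((k(i := k i + m)) j) * x j)
      = (\<Sum>j<n. of_int (k j) * x j + (if j = i then of_int m * x i else 0))"
    by (intro sum.cong) (auto simp: algebra_simps)
  also have "\<dots> = (\<Sum>j<n. of_int (k j) * x j) + of_int m * x i"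
    using assms by (simp add: sum.distrib sum.delta)
  finally show ?thesis by (simp add: torus_char_def cis_mult)
qed

text \<open>The frequencies are integers, so the translation by \<open>2 * pi\<close> contributes a
  factor 1 and only the sign change of \<open>x\<close> remains.\<close>

lemma torus_char_reflect: "torus_char n k (torus_reflect n x) = cnj (torus_char n k x)"
proof -
  have "(\<Sum>i<n. of_int (k i) * torus_reflect n x i)
      = 2 * pi * of_int (\<Sum>i<n. k i) - (\<Sum>i<n. of_int (k i) * x i)"
    by (simp add: torus_reflect_def sum_subtractf[symmetric] sum_distrib_left algebra_simps)
  then have "torus_char n k (torus_reflect n x)
      = cis (- (2 * pi * of_int (\<Sum>i<n. k i))) * cis (\<Sum>i<n. of_int (k i) * x i)"
    by (simp only: torus_char_def cis_mult) (simp add: algebra_simps)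
  also have "cis (- (2 * pi * of_int (\<Sum>i<n. k i))) = 1"
    using cis_multiple_2pi[of "- of_int (\<Sum>i<n. k i)"] by (simp del: of_int_sum)
  finally show ?thesis by (simp add: torus_char_def cis_cnj)
qed

lemma fourier_coeff_torus_char:
  "fourier_coeff n g k =
     (LINT x : torus_box n | torus_measure n. g x * torus_char n k x) / of_real ((2 * pi) ^ n)"
  by (simp add: fourier_coeff_def torus_char_def)

subsection \<open>Reflection\<close>

lemma distr_lborel_reflect: "distr lborel borel (\<lambda>x. a - x) = (lborel :: real measure)"
  using lborel_real_affine[of "-1" a] by (simp add: density_1)

lemma torus_reflect_measurable [measurable]:
  "torus_reflect n \<in> measurable (torus_measure n) (torus_measure n)"
  unfolding torus_reflect_def by measurable

lemma torus_reflect_reflect: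
  "x \<in> {..<n} \<rightarrow>\<^sub>E UNIV \<Longrightarrow> torus_reflect n (torus_reflect n x) = x"
  by (auto simp: torus_reflect_def fun_eq_iff PiE_def extensional_def)

lemma torus_reflect_in_box_iff:
  "x \<in> {..<n} \<rightarrow>\<^sub>E UNIV \<Longrightarrow> torus_reflect n x \<in> torus_box n \<longleftrightarrow> x \<in> torus_box n"
  by (auto simp: torus_reflect_def PiE_iff)

lemma space_torus_measure: "space (torus_measure n) = {..<n} \<rightarrow>\<^sub>E UNIV"
  by (simp add: space_PiM)

text \<open>The product measure is determined by its values on measurable boxes. The preimage of a
  box is again a box, and in each coordinate Lebesgue measure is invariant under \<open>t\<close> to
  \<open>2 * pi - t\<close>.\<close>

lemma distr_torus_reflect:
  "distr (torus_measure n) (torus_measure n) (torus_reflect n) = torus_measure n"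
proof -
  interpret product_sigma_finite "\<lambda>i::nat. lborel :: real measure"
    by (rule product_sigma_finite_lborel)
  show ?thesis
  proof (rule PiM_eqI)
    fix A :: "nat \<Rightarrow> real set" assume A: "\<And>i. i \<in> {..<n} \<Longrightarrow> A i \<in> sets lborel"
    have vim: "(\<lambda>t. 2 * pi - t) -` A i \<in> sets lborel" if "i < n" for i
      using measurable_sets[of "\<lambda>t. 2 * pi - t" borel borel "A i"] A[of i] that by simp
    have "torus_reflect n -` (Pi\<^sub>E {..<n} A) \<inter> space (torus_measure n)
        = Pi\<^sub>E {..<n} (\<lambda>i. (\<lambda>t. 2 * pi - t) -` A i)"
      by (auto simp: torus_reflect_def space_torus_measure PiE_iff)
    then have "emeasure (distr (torus_measure n) (torus_measure n) (torus_reflect n)) (Pi\<^sub>E {..<n} A)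
        = emeasure (torus_measure n) (Pi\<^sub>E {..<n} (\<lambda>i. (\<lambda>t. 2 * pi - t) -` A i))"
      using A by (subst emeasure_distr) (auto intro!: sets_PiM_I_finite)
    also have "\<dots> = (\<Prod>i<n. emeasure lborel ((\<lambda>t. 2 * pi - t) -` A i))"
      using vim by (intro emeasure_PiM) auto
    also have "\<dots> = (\<Prod>i<n. emeasure lborel (A i))"
    proof (rule prod.cong)
      fix i assume "i \<in> {..<n}"
      then have "A i \<in> sets borel" using A by simp
      then have "emeasure (distr lborel borel (\<lambda>t. 2 * pi - t)) (A i)
          = emeasure lborel ((\<lambda>t. 2 * pi - t) -` A i)"
        by (subst emeasure_distr) auto
      then show "emeasure lborel ((\<lambda>t. 2 * pi - t) -` A i) = emeasure lborel (A i)"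
        by (simp add: distr_lborel_reflect)
    qed simp
    finally show "emeasure (distr (torus_measure n) (torus_measure n) (torus_reflect n)) (Pi\<^sub>E {..<n} A)
        = (\<Prod>i\<in>{..<n}. emeasure lborel (A i))" .
  qed auto
qed

text \<open>As the reflection is an involution, \<open>g\<close> is measurable iff its
  reflection is, and otherwise both integrals are \<open>0\<close>.\<close>

lemma integral_torus_reflect:
  fixes g :: "(nat \<Rightarrow> real) \<Rightarrow> complex"
  shows "(LINT x | torus_measure n. g (torus_reflect n x)) = (LINT x | torus_measure n. g x)"
proof (cases "g \<in> borel_measurable (torus_measure n)")
  case True
  then show ?thesis
    using integral_distr[OF torus_reflect_measurable True] by (simp add: distr_torus_reflect)
next
  case False
  have "(\<lambda>x. g (torus_reflect n x)) \<notin> borel_measurable (torus_measure n)"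
  proof
    assume "(\<lambda>x. g (torus_reflect n x)) \<in> borel_measurable (torus_measure n)"
    from measurable_compose[OF torus_reflect_measurable this]
    have "(\<lambda>x. g (torus_reflect n (torus_reflect n x))) \<in> borel_measurable (torus_measure n)" .
    also have "?this \<longleftrightarrow> g \<in> borel_measurable (torus_measure n)"
      by (rule measurable_cong) (simp add: space_torus_measure torus_reflect_reflect)
    finally show False using False by simp
  qed
  with False show ?thesis
    by (metis borel_measurable_integrable not_integrable_integral_eq)
qed

text \<open>Substitute the reflection in the integral: it preserves the measure and the box and
  conjugates the character. Both this substitution and pulling \<open>cnj\<close> out of the
  integral hold without integrability, so \<open>g\<close> is arbitrary.\<close>

lemma fourier_coeff_cnj_reflect:
  "fourier_coeff n (\<lambda>x. cnj (g (torus_reflect n x))) k = cnj (fourier_coeff n g k)"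
proof -
  let ?F = "\<lambda>x. cnj (indicator (torus_box n) x *\<^sub>R (g x * torus_char n k x))"
  have "(LINT x : torus_box n | torus_measure n. cnj (g (torus_reflect n x)) * torus_char n k x)
      = (LINT x | torus_measure n. ?F (torus_reflect n x))"
    unfolding set_lebesgue_integral_def
    by (rule Bochner_Integration.integral_cong)
       (auto simp: torus_char_reflect space_torus_measure torus_reflect_in_box_iff indicator_def)
  also have "\<dots> = (LINT x | torus_measure n. ?F x)"
    by (rule integral_torus_reflect)
  also have "\<dots> = cnj (LINT x : torus_box n | torus_measure n. g x * torus_char n k x)"
    unfolding set_lebesgue_integral_def by (rule Bochner_Integration.integral_cnj)
  finally show ?thesis by (simp add: fourier_coeff_torus_char)
qed

subsection \<open>Continuous functions on products\<close>

text \<open>An epsilon-delta form of continuity. The product topology supplies an open box around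
  \<open>x0\<close> inside the preimage of a ball, and as \<open>I\<close> is finite, the least of
  the radii of its sides gives a cube.\<close>

lemma continuous_map_product_real_nbhd:
  fixes g :: "('i \<Rightarrow> real) \<Rightarrow> 'b::metric_space"
  assumes "finite I" and g: "continuous_map (product_topology (\<lambda>_. euclideanreal) I) euclidean g"
    and x0: "x0 \<in> I \<rightarrow>\<^sub>E UNIV" and "e > 0"
  obtains d where "d > 0"
    "\<forall>x \<in> I \<rightarrow>\<^sub>E UNIV. (\<forall>i\<in>I. \<bar>x i - x0 i\<bar> < d) \<longrightarrow> dist (g x) (g x0) < e"
proof -
  let ?X = "product_topology (\<lambda>_. euclideanreal) I"
  let ?S = "{x \<in> topspace ?X. g x \<in> ball (g x0) e}"
  have "openin ?X ?S"
    using g by (rule openin_continuous_map_preimage) simp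
  moreover have "x0 \<in> ?S" using x0 \<open>e > 0\<close> by simp
  ultimately obtain U where "\<forall>i\<in>I. openin euclideanreal (U i)"
    and U2: "x0 \<in> Pi\<^sub>E I U" "Pi\<^sub>E I U \<subseteq> ?S"
    unfolding openin_product_topology_alt by blast
  then have U: "\<And>i. i \<in> I \<Longrightarrow> open (U i)" "x0 \<in> Pi\<^sub>E I U" "Pi\<^sub>E I U \<subseteq> ?S"
    by auto
  have "\<exists>d>0. ball (x0 i) d \<subseteq> U i" if "i \<in> I" for i
    using U(1)[OF that] U(2) that by (auto simp: open_contains_ball PiE_iff)
  then obtain d where d: "\<And>i. i \<in> I \<Longrightarrow> d i > 0" "\<And>i. i \<in> I \<Longrightarrow> ball (x0 i) (d i) \<subseteq> U i"
    by metis
  define D where "D = Min (insert 1 (d ` I))"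
  have D: "D > 0" "\<And>i. i \<in> I \<Longrightarrow> D \<le> d i"
    using d \<open>finite I\<close> by (auto simp: D_def)
  have "dist (g x) (g x0) < e"
    if "x \<in> I \<rightarrow>\<^sub>E UNIV" and near: "\<And>i. i \<in> I \<Longrightarrow> \<bar>x i - x0 i\<bar> < D" for x
  proof -
    have "x i \<in> U i" if "i \<in> I" for i
      using near[OF that] D(2)[OF that] d(2)[OF that] by (force simp: dist_real_def)
    then have "x \<in> Pi\<^sub>E I U" using that by (auto simp: PiE_iff)
    then show ?thesis using U(3) by (auto simp: dist_commute)
  qed
  with D(1) show thesis by (intro that) blast+
qed

text \<open>Continuity refers to extensional functions on \<open>I\<close>, while the Borel
  structure lives on the full function type. Precomposing \<open>g\<close> with restriction to
  \<open>I\<close> gives a continuous function on the full type; composing that with extension by 0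
  recovers \<open>g\<close> on the space of the product measure.\<close>

lemma borel_measurable_continuous_map_product:
  fixes g :: "('i::countable \<Rightarrow> real) \<Rightarrow> 'b::topological_space"
  assumes g: "continuous_map (product_topology (\<lambda>_. euclideanreal) I) euclidean g"
  shows "g \<in> borel_measurable (\<Pi>\<^sub>M i\<in>I. lborel)"
proof -
  have "continuous_map (product_topology (\<lambda>_. euclideanreal) UNIV)
      (product_topology (\<lambda>_. euclideanreal) I) (\<lambda>x. restrict x I)"
    by (auto simp: continuous_map_componentwise intro!: continuous_map_product_projection)
  from continuous_map_compose[OF this g]
  have "continuous_on UNIV (\<lambda>x. g (restrict x I))"
    by (simp add: euclidean_product_topology o_def)
  then have *: "(\<lambda>x. g (restrict x I)) \<in> borel_measurable borel"
    by (rule borel_measurable_continuous_onI)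
  have "(\<lambda>x i. if i \<in> I then x i else 0) \<in> measurable (\<Pi>\<^sub>M i\<in>I. lborel) (\<Pi>\<^sub>M i\<in>UNIV. (borel :: real measure))"
  proof (rule measurable_PiM_single')
    show "(\<lambda>x. if i \<in> I then x i else 0) \<in> measurable (\<Pi>\<^sub>M i\<in>I. lborel) (borel :: real measure)" for i
      by (cases "i \<in> I") auto
  qed auto
  then have "(\<lambda>x i. if i \<in> I then x i else 0) \<in> measurable (\<Pi>\<^sub>M i\<in>I. lborel) (borel :: ('i \<Rightarrow> real) measure)"
    by (simp cong: measurable_cong_sets add: sets_PiM_equal_borel)
  from measurable_compose[OF this *]
  have "(\<lambda>x. g (restrict (\<lambda>i. if i \<in> I then x i else 0) I)) \<in> borel_measurable (\<Pi>\<^sub>M i\<in>I. lborel)" .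
  also have "?this \<longleftrightarrow> g \<in> borel_measurable (\<Pi>\<^sub>M i\<in>I. lborel)"
  proof (rule measurable_cong)
    fix x :: "'i \<Rightarrow> real" assume "x \<in> space (\<Pi>\<^sub>M i\<in>I. lborel)"
    then have "restrict (\<lambda>i. if i \<in> I then x i else 0) I = x"
      by (auto simp: space_PiM fun_eq_iff PiE_def extensional_def)
    then show "g (restrict (\<lambda>i. if i \<in> I then x i else 0) I) = g x" by simp
  qed
  finally show ?thesis .
qed

text \<open>The box is compact as a product of compact intervals.\<close>

lemma torus_box_bounded_image:
  fixes g :: "(nat \<Rightarrow> real) \<Rightarrow> 'b::real_normed_vector"
  assumes "continuous_map (product_topology (\<lambda>_. euclideanreal) {..<n}) euclidean g"
  obtains B where "\<And>x. x \<in> torus_box n \<Longrightarrow> norm (g x) \<le> B"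
proof -
  have "compactin (product_topology (\<lambda>_. euclideanreal) {..<n}) (torus_box n)"
    by (simp add: compactin_PiE)
  from image_compactin[OF this assms] have "compact (g ` torus_box n)" by simp
  then have "bounded (g ` torus_box n)" by (rule compact_imp_bounded)
  with that show thesis by (auto simp: bounded_iff)
qed

lemma torus_reflect_continuous:
  "continuous_map (product_topology (\<lambda>_. euclideanreal) {..<n})
     (product_topology (\<lambda>_. euclideanreal) {..<n}) (torus_reflect n)"
  unfolding torus_reflect_def
  by (auto simp: continuous_map_componentwise
      intro!: continuous_map_diff continuous_map_product_projection)

subsection \<open>Uniqueness of Fourier coefficients\<close>

lemma torus_box_integrable:
  fixes g :: "(nat \<Rightarrow> real) \<Rightarrow> 'b::{banach, second_countable_topology}"
  assumes [measurable]: "g \<in> borel_measurable (torus_measure n)"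
    and "\<And>x. x \<in> torus_box n \<Longrightarrow> norm (g x) \<le> B"
  shows "set_integrable (torus_measure n) (torus_box n) g"
  unfolding set_integrable_def
  by (rule integrableI_bounded_set[where A = "torus_box n" and B = B])
     (use assms emeasure_torus_box_finite[of n] in auto)

text \<open>Measurability and boundedness on the box replace continuity: they ensure integrability
  and are easily seen to survive multiplication by cosine factors. The index \<open>k\<close> ranges
  over all functions, so shifted frequencies carry no side condition.\<close>

definition fourier_null :: "nat \<Rightarrow> ((nat \<Rightarrow> real) \<Rightarrow> complex) \<Rightarrow> bool" where
  "fourier_null n g \<longleftrightarrow>
     g \<in> borel_measurable (torus_measure n) \<and>
     (\<exists>B. \<forall>x \<in> torus_box n. norm (g x) \<le> B) \<and>
     (\<forall>k. (LINT x : torus_box n | torus_measure n. g x * torus_char n k x) = 0)"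

lemma fourier_null_integrable:
  assumes "fourier_null n g"
  shows "set_integrable (torus_measure n) (torus_box n) (\<lambda>x. g x * torus_char n k x)"
proof -
  obtain B where "\<And>x. x \<in> torus_box n \<Longrightarrow> norm (g x) \<le> B"
    and [measurable]: "g \<in> borel_measurable (torus_measure n)"
    using assms by (auto simp: fourier_null_def)
  then show ?thesis
    by (intro torus_box_integrable[where B = B]) (auto simp: norm_mult)
qed

lemma cos_factor_bounds: "0 \<le> (1 + cos t) / 2" "(1 + cos t) / 2 \<le> (1::real)"
  using cos_ge_minus_one[of t] cos_le_one[of t] by (simp_all, linarith)

text \<open>By Euler's formula the factor is a combination of the exponentials with frequencies -1,
  0 and 1 in coordinate \<open>i\<close>. Each new coefficient is therefore a combination of three
  old ones, all zero.\<close>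

lemma fourier_null_mult_cos:
  assumes g: "fourier_null n g" and "i < n"
  shows "fourier_null n (\<lambda>x. g x * of_real ((1 + cos (x i - a)) / 2))"
proof -
  obtain B where B: "\<And>x. x \<in> torus_box n \<Longrightarrow> norm (g x) \<le> B"
    and [measurable]: "g \<in> borel_measurable (torus_measure n)"
    using g by (auto simp: fourier_null_def)
  have [measurable]: "(\<lambda>x. x i) \<in> borel_measurable (torus_measure n)"
    using measurable_component_singleton[of i "{..<n}" "\<lambda>_. lborel :: real measure"] \<open>i < n\<close> by simp
  have "norm (g x * of_real ((1 + cos (x i - a)) / 2)) \<le> B" if "x \<in> torus_box n" for x
  proof -
    have "\<bar>(1 + cos (x i - a)) / 2\<bar> \<le> 1"
      using cos_factor_bounds[of "x i - a"] by (simp only: abs_of_nonneg)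
    then have "norm (g x) * \<bar>(1 + cos (x i - a)) / 2\<bar> \<le> B * 1"
      using B[OF that] order_trans[OF norm_ge_zero B[OF that]] by (intro mult_mono) auto
    then show ?thesis by (simp add: norm_mult del: of_real_divide)
  qed
  moreover have "(LINT x : torus_box n | torus_measure n.
      g x * of_real ((1 + cos (x i - a)) / 2) * torus_char n k x) = 0" for k
  proof -
    \<comment> \<open>\<open>?I m\<close> is the integrand of the coefficient whose
      \<open>i\<close>-th frequency is shifted by \<open>m\<close>.\<close>
    let ?I = "\<lambda>m x. g x * torus_char n (k(i := k i + m)) x"
    have cos_cis: "complex_of_real (cos t) = (cis t + cis (- t)) / 2" for t
      by (simp add: complex_eq_iff)
    have cis_split: "cis (u - a) = cis u * cis (- a)" "cis (a - u) = cis a * cis (- u)" for u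
      by (simp_all add: cis_mult)
    have eq: "g x * of_real ((1 + cos (x i - a)) / 2) * torus_char n k x
        = 1 / 2 * ?I 0 x + (cis (- a) / 4 * ?I (-1) x + cis a / 4 * ?I 1 x)" for x
      unfolding torus_char_shift[OF \<open>i < n\<close>] of_real_divide of_real_add cos_cis
      by (simp add: cis_split algebra_simps)
    have int: "set_integrable (torus_measure n) (torus_box n) (\<lambda>x. c * ?I m x)" for c m
      using fourier_null_integrable[OF g] by (intro set_integrable_mult_right) auto
    have zero: "(LINT x : torus_box n | torus_measure n. c * ?I m x) = 0" for c m
      using g by (simp add: fourier_null_def)
    show ?thesis
      unfolding eq by (simp only: set_integral_add int zero add_0)
  qed
  ultimately show ?thesis unfolding fourier_null_def by (auto intro!: exI[of _ B])
qed

section \<open>The kernel peaking at a point\<close>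

definition torus_kernel :: "nat \<Rightarrow> (nat \<Rightarrow> real) \<Rightarrow> (nat \<Rightarrow> real) \<Rightarrow> real" where
  "torus_kernel n y x = (\<Prod>i<n. (1 + cos (x i - y i)) / 2)"

lemma torus_kernel_bounds: "0 \<le> torus_kernel n y x" "torus_kernel n y x \<le> 1"
  unfolding torus_kernel_def using cos_factor_bounds by (auto intro!: prod_nonneg prod_le_1)

text \<open>The other factors lie between 0 and 1. So a single coordinate far from that of
  \<open>y\<close> already keeps the kernel away from 1.\<close>

lemma torus_kernel_le_factor:
  assumes "i < n" shows "torus_kernel n y x \<le> (1 + cos (x i - y i)) / 2"
proof -
  have "torus_kernel n y x
      = (1 + cos (x i - y i)) / 2 * (\<Prod>j\<in>{..<n} - {i}. (1 + cos (x j - y j)) / 2)"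
    unfolding torus_kernel_def using assms by (simp add: prod.remove)
  also have "\<dots> \<le> (1 + cos (x i - y i)) / 2 * 1"
    using cos_factor_bounds by (intro mult_left_mono prod_le_1) auto
  finally show ?thesis by simp
qed

lemma torus_kernel_continuous:
  "continuous_map (product_topology (\<lambda>_. euclideanreal) {..<n}) euclidean (torus_kernel n y)"
proof -
  have "continuous_map (product_topology (\<lambda>_. euclideanreal) {..<n}) euclideanreal
      (\<lambda>x. (1 + cos (x i - y i)) / 2)" if "i < n" for i
  proof -
    have "continuous_map euclideanreal euclideanreal (\<lambda>t. (1 + cos (t - y i)) / 2)"
      by (auto intro!: continuous_intros)
    with continuous_map_product_projection[of i "{..<n}" "\<lambda>_. euclideanreal"] that
    have "continuous_map (product_topology (\<lambda>_. euclideanreal) {..<n}) euclideanreal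
        ((\<lambda>t. (1 + cos (t - y i)) / 2) \<circ> (\<lambda>x. x i))"
      by (intro continuous_map_compose) auto
    then show ?thesis by (simp add: o_def)
  qed
  then show ?thesis unfolding torus_kernel_def by (intro continuous_map_prod) auto
qed

lemma fourier_null_mult_kernel:
  assumes g: "fourier_null n g"
  shows "fourier_null n (\<lambda>x. g x * of_real (torus_kernel n y x))"
proof -
  \<comment> \<open>Partial products over subsets \<open>J\<close> make an induction possible that
    adds one cosine factor at a time.\<close>
  have "fourier_null n (\<lambda>x. g x * of_real (\<Prod>i\<in>J. (1 + cos (x i - y i)) / 2))"
    if "finite J" "J \<subseteq> {..<n}" for J
    using that
  proof (induction J)
    case (insert i J)
    then show ?case
      using fourier_null_mult_cos[of n "\<lambda>x. g x * of_real (\<Prod>i\<in>J. (1 + cos (x i - y i)) / 2)" i "y i"]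
      by (simp add: mult_ac)
  qed (simp add: g)
  from this[of "{..<n}"] show ?thesis by (simp add: torus_kernel_def)
qed

lemma fourier_null_mult_kernel_power:
  assumes "fourier_null n g"
  shows "fourier_null n (\<lambda>x. g x * of_real (torus_kernel n y x ^ N))"
proof (induction N)
  case (Suc N)
  from fourier_null_mult_kernel[OF Suc, of y] show ?case by (simp add: mult_ac)
qed (simp add: assms)

section \<open>The concentration argument\<close>

text \<open>Let \<open>V\<close> be the set in question. On \<open>V\<close> the integrand is at
  least \<open>c * s ^ N\<close>; elsewhere in \<open>A\<close> it is nonnegative where
  \<open>r < K x\<close>, and at least \<open>- B * r ^ N\<close> where \<open>K x \<le> r\<close>.
  Since the integral is 0, \<open>c * measure M V\<close> is at most
  \<open>B * measure M A * (r / s) ^ N\<close>, which tends to 0.\<close>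

lemma measure_peak_zero:
  fixes g K :: "'a \<Rightarrow> real"
  assumes [measurable]: "A \<in> sets M" "g \<in> borel_measurable M" "K \<in> borel_measurable M"
    and fin: "emeasure M A < \<infinity>"
    and B: "\<And>x. x \<in> A \<Longrightarrow> \<bar>g x\<bar> \<le> B"
    and K: "\<And>x. x \<in> A \<Longrightarrow> 0 \<le> K x" "\<And>x. x \<in> A \<Longrightarrow> K x \<le> 1"
    and rs: "0 \<le> r" "r < s" and "c > 0"
    and g: "\<And>x. x \<in> A \<Longrightarrow> r < K x \<Longrightarrow> c \<le> g x"
    and zero: "\<And>N. (LINT x : A | M. g x * K x ^ N) = 0"
  shows "measure M {x \<in> A. s \<le> K x} = 0"
proof -
  define V where "V = {x \<in> A. s \<le> K x}"
  have V [measurable]: "V \<in> sets M"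
  proof -
    have "V = A \<inter> {x \<in> space M. s \<le> K x}"
      using sets.sets_into_space[OF assms(1)] by (auto simp: V_def)
    then show ?thesis by simp
  qed
  have "V \<subseteq> A" by (auto simp: V_def)
  then have finV: "emeasure M V < \<infinity>"
    using emeasure_mono[of V A M] fin by auto
  have "s > 0" using rs by simp
  have bound: "c * measure M V \<le> B * measure M A * (r / s) ^ N" for N
  proof -
    have int1: "integrable M (\<lambda>x. indicator A x *\<^sub>R (g x * K x ^ N))"
    proof (rule integrableI_bounded_set[where A = A and B = B])
      have "\<bar>g x\<bar> * \<bar>K x ^ N\<bar> \<le> B * 1" if "x \<in> A" for x
        using B[OF that] K[OF that] abs_ge_zero[of "g x"]
        by (intro mult_mono) (auto simp: power_le_one power_abs)
      then show "AE x in M. x \<in> A \<longrightarrow> norm (indicator A x *\<^sub>R (g x * K x ^ N)) \<le> B"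
        by (simp add: abs_mult)
    qed (use fin in auto)
    have int2: "integrable M (\<lambda>x. c * s ^ N * indicator V x - B * r ^ N * indicator A x)"
      using fin finV by (intro Bochner_Integration.integrable_diff integrable_mult_right) auto
    \<comment> \<open>Pointwise minorant: the gain is counted only on \<open>V\<close>, the worst
      possible loss on all of \<open>A\<close>.\<close>
    have "c * s ^ N * indicator V x - B * r ^ N * indicator A x
        \<le> indicator A x *\<^sub>R (g x * K x ^ N)" for x
    proof (cases "x \<in> A")
      case False
      with \<open>V \<subseteq> A\<close> show ?thesis by (auto simp: indicator_def)
    next
      case A: True
      have "0 \<le> B" using B[OF A] by linarith
      have Br: "0 \<le> B * r ^ N" using \<open>0 \<le> B\<close> rs by simp
      show ?thesis
      proof (cases "r < K x")
        case True
        have "c * s ^ N * indicator V x \<le> g x * K x ^ N"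
        proof (cases "x \<in> V")
          case True
          then have "s ^ N \<le> K x ^ N" using \<open>s > 0\<close> by (auto simp: V_def intro!: power_mono)
          then have "c * s ^ N \<le> g x * K x ^ N"
            using g[OF A \<open>r < K x\<close>] \<open>c > 0\<close> \<open>s > 0\<close> by (intro mult_mono) auto
          with True show ?thesis by simp
        next
          case False
          then show ?thesis using g[OF A \<open>r < K x\<close>] \<open>c > 0\<close> K(1)[OF A] by simp
        qed
        with A Br show ?thesis by simp
      next
        case False
        then have "K x ^ N \<le> r ^ N" using K(1)[OF A] by (intro power_mono) auto
        then have "\<bar>g x\<bar> * K x ^ N \<le> B * r ^ N"
          using B[OF A] K(1)[OF A] \<open>0 \<le> B\<close> by (intro mult_mono) auto
        moreover have "- (\<bar>g x\<bar> * K x ^ N) \<le> g x * K x ^ N"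
          using K(1)[OF A] mult_right_mono[of "- \<bar>g x\<bar>" "g x" "K x ^ N"] by simp
        moreover have "x \<notin> V" using False rs by (auto simp: V_def)
        ultimately show ?thesis using A by simp
      qed
    qed
    from integral_mono[OF int2 int1 this]
    have "(LINT x|M. c * s ^ N * indicator V x - B * r ^ N * indicator A x) \<le> 0"
      using zero[of N] by (simp add: set_lebesgue_integral_def)
    moreover have "(LINT x|M. c * s ^ N * indicator V x - B * r ^ N * indicator A x)
        = c * s ^ N * measure M V - B * r ^ N * measure M A"
      using fin finV by (subst Bochner_Integration.integral_diff) auto
    ultimately show ?thesis using \<open>s > 0\<close> by (simp add: power_divide field_simps)
  qed
  have "(\<lambda>N. B * measure M A * (r / s) ^ N) \<longlonglongrightarrow> B * measure M A * 0"
    using rs by (intro tendsto_mult tendsto_const LIMSEQ_realpow_zero) auto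
  then have "c * measure M V \<le> B * measure M A * 0"
    using bound by (intro LIMSEQ_le_const) auto
  then show ?thesis
    using \<open>c > 0\<close> by (simp add: V_def[symmetric] mult_le_0_iff measure_le_0_iff)
qed

text \<open>If \<open>g y\<close> were nonzero, the concentration argument would make a superlevel
  set of the kernel null, although this set contains a cube around \<open>y\<close>.\<close>

lemma fourier_null_eq_0_interior:
  assumes cont: "continuous_map (product_topology (\<lambda>_. euclideanreal) {..<n}) euclidean g"
    and null: "fourier_null n g" and y: "y \<in> {..<n} \<rightarrow>\<^sub>E {0<..<2 * pi}"
  shows "g y = 0"
proof (rule ccontr)
  assume "g y \<noteq> 0"
  interpret product_sigma_finite "\<lambda>i::nat. lborel :: real measure"
    by (rule product_sigma_finite_lborel)
  let ?M = "torus_measure n" and ?A = "torus_box n"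
  let ?K = "torus_kernel n y"
  \<comment> \<open>Rotating by \<open>cnj (g y)\<close> makes the value at \<open>y\<close> real
    and positive; \<open>c\<close> is half of that value, so that \<open>G\<close> stays above
    \<open>c\<close> near \<open>y\<close>.\<close>
  define G where "G x = Re (cnj (g y) * g x)" for x
  define c where "c = (norm (g y))\<^sup>2 / 2"
  have "c > 0" using \<open>g y \<noteq> 0\<close> by (simp add: c_def)
  have Gy: "G y = 2 * c"
    unfolding G_def c_def cmod_power2 by (simp add: power2_eq_square)
  have yU: "y \<in> {..<n} \<rightarrow>\<^sub>E UNIV" using y by (auto simp: PiE_iff)
  have [measurable]: "g \<in> borel_measurable ?M" "?K \<in> borel_measurable ?M"
    using cont torus_kernel_continuous by (auto intro: borel_measurable_continuous_map_product)
  have Gm [measurable]: "G \<in> borel_measurable ?M" unfolding G_def by measurable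
  obtain B where B: "\<And>x. x \<in> ?A \<Longrightarrow> norm (g x) \<le> B"
    by (rule torus_box_bounded_image[OF cont]) (rule that)
  have contG: "continuous_map (product_topology (\<lambda>_. euclideanreal) {..<n}) euclidean G"
  proof -
    have "continuous_map euclidean euclideanreal (\<lambda>z. Re (cnj (g y) * z))"
      by (auto intro!: continuous_intros)
    from continuous_map_compose[OF cont this] show ?thesis by (simp add: G_def[abs_def] o_def)
  qed
  obtain d0 where d0: "d0 > 0"
    "\<forall>x \<in> {..<n} \<rightarrow>\<^sub>E UNIV. (\<forall>i\<in>{..<n}. \<bar>x i - y i\<bar> < d0) \<longrightarrow> dist (G x) (G y) < c"
    by (rule continuous_map_product_real_nbhd[OF finite_lessThan contG yU \<open>c > 0\<close>]) (rule that)
  \<comment> \<open>\<open>D\<close> bounds from below the distance of every coordinate of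
    \<open>y\<close> to the ends of its interval. The inserted 1 covers \<open>n = 0\<close> and
    keeps \<open>D\<close> below \<open>pi\<close>.\<close>
  define D where "D = Min (insert 1 ((\<lambda>i. min (y i) (2 * pi - y i)) ` {..<n}))"
  have "0 < D" using y by (auto simp: D_def PiE_iff)
  have D: "D \<le> y i" "y i \<le> 2 * pi - D" if "i < n" for i
  proof -
    have "D \<le> min (y i) (2 * pi - y i)" unfolding D_def using that by (intro Min_le) auto
    then show "D \<le> y i" "y i \<le> 2 * pi - D" by auto
  qed
  have "D \<le> 1" by (simp add: D_def)
  define d where "d = min d0 D"
  have d: "0 < d" "d \<le> d0" "d \<le> D" using d0(1) \<open>0 < D\<close> by (auto simp: d_def)
  \<comment> \<open>\<open>r\<close> is the value of one cosine factor at distance \<open>d\<close>.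
    The later choice of \<open>s\<close> strictly between \<open>r\<close> and 1, the peak value,
    makes \<open>r / s\<close> less than 1 and leaves room for a cube where the kernel exceeds
    \<open>s\<close>.\<close>
  define r where "r = (1 + cos d) / 2"
  have "r < 1"
    using cos_monotone_0_pi[of 0 d] d \<open>D \<le> 1\<close> pi_gt3 by (simp add: r_def)
  have "0 \<le> r" unfolding r_def by (rule cos_factor_bounds)
  define s where "s = (1 + r) / 2"
  have s: "r < s" "s < 1" using \<open>r < 1\<close> by (auto simp: s_def)
  have far: "?K x \<le> r" if x: "x \<in> ?A" and i: "i < n" "d \<le> \<bar>x i - y i\<bar>" for x i
  proof -
    have "0 \<le> x i" "x i \<le> 2 * pi" using x i by (auto simp: PiE_iff)
    then have le: "\<bar>x i - y i\<bar> \<le> 2 * pi - d" using D[OF i(1)] d by linarith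
    have "cos \<bar>x i - y i\<bar> \<le> cos d"
    proof (cases "\<bar>x i - y i\<bar> \<le> pi")
      case True
      then show ?thesis using i d by (intro cos_monotone_0_pi_le) auto
    next
      case False
      \<comment> \<open>Beyond \<open>pi\<close> the cosine grows again, but the distance of
        \<open>y\<close> to the faces of the box keeps the difference at least \<open>d\<close>
        short of a full period.\<close>
      have "cos (2 * pi - \<bar>x i - y i\<bar>) \<le> cos d"
        using False le d by (intro cos_monotone_0_pi_le) auto
      then show ?thesis by (simp add: cos_diff)
    qed
    then show ?thesis using torus_kernel_le_factor[OF i(1), of y x] by (simp add: r_def)
  qed
  have "measure ?M {x \<in> ?A. s \<le> ?K x} = 0"
  proof (rule measure_peak_zero)
    show "emeasure ?M ?A < \<infinity>" by (rule emeasure_torus_box_finite)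
    show "\<bar>G x\<bar> \<le> norm (g y) * B" if "x \<in> ?A" for x
    proof -
      have "\<bar>G x\<bar> \<le> norm (cnj (g y) * g x)" unfolding G_def by (rule abs_Re_le_cmod)
      also have "\<dots> \<le> norm (g y) * B" using B[OF that] by (simp add: norm_mult mult_left_mono)
      finally show ?thesis .
    qed
    show "c \<le> G x" if x: "x \<in> ?A" and "r < ?K x" for x
    proof -
      have "\<bar>x i - y i\<bar> < d0" if "i \<in> {..<n}" for i
        using far[OF x, of i] \<open>r < ?K x\<close> that d(2) by force
      then have "dist (G x) (G y) < c" using x by (intro d0(2)[rule_format]) (auto simp: PiE_iff)
      then show ?thesis using Gy by (simp add: dist_real_def)
    qed
    show "(LINT x : ?A | ?M. G x * ?K x ^ N) = 0" for N
    proof -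
      let ?h = "\<lambda>x. g x * of_real (?K x ^ N)"
      have null': "fourier_null n ?h" by (rule fourier_null_mult_kernel_power[OF null])
      \<comment> \<open>The integral of the product itself is its coefficient at frequency
        0.\<close>
      have one: "torus_char n (\<lambda>_. 0) x = 1" for x by (simp add: torus_char_def)
      have int: "set_integrable ?M ?A (\<lambda>x. cnj (g y) * ?h x)"
        using fourier_null_integrable[OF null', of "\<lambda>_. 0"] unfolding one
        by (intro set_integrable_mult_right) simp
      have "(LINT x : ?A | ?M. ?h x * torus_char n (\<lambda>_. 0) x) = 0"
        using null' unfolding fourier_null_def by blast
      then have zero: "(LINT x : ?A | ?M. cnj (g y) * ?h x) = 0"
        unfolding one by simp
      have "(LINT x : ?A | ?M. G x * ?K x ^ N)
          = (LINT x | ?M. Re (indicator ?A x *\<^sub>R (cnj (g y) * ?h x)))"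
        unfolding set_lebesgue_integral_def
        by (rule Bochner_Integration.integral_cong)
           (auto simp: G_def indicator_def algebra_simps simp flip: of_real_power)
      also have "\<dots> = Re (LINT x : ?A | ?M. cnj (g y) * ?h x)"
        using int unfolding set_lebesgue_integral_def set_integrable_def by (rule integral_Re)
      finally show ?thesis unfolding zero by simp
    qed
  qed (use \<open>0 \<le> r\<close> \<open>c > 0\<close> s torus_kernel_bounds in auto)
  moreover have "measure ?M {x \<in> ?A. s \<le> ?K x} > 0"
  proof -
    have s1: "1 - s > 0" using s by simp
    obtain e0 where e0: "e0 > 0"
      "\<forall>x \<in> {..<n} \<rightarrow>\<^sub>E UNIV. (\<forall>i\<in>{..<n}. \<bar>x i - y i\<bar> < e0) \<longrightarrow> dist (?K x) (?K y) < 1 - s"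
      by (rule continuous_map_product_real_nbhd[OF finite_lessThan torus_kernel_continuous[of n y] yU s1]) (rule that)
    define e where "e = min e0 D"
    have e: "0 < e" "e \<le> e0" "e \<le> D" using e0(1) \<open>0 < D\<close> by (auto simp: e_def)
    let ?V = "\<Pi>\<^sub>E i\<in>{..<n}. {y i - e<..<y i + e}"
    have Ky: "?K y = 1" by (simp add: torus_kernel_def)
    have "?V \<subseteq> {x \<in> ?A. s \<le> ?K x}"
    proof
      fix x assume x: "x \<in> ?V"
      have near: "\<bar>x i - y i\<bar> < e" if "i < n" for i
      proof -
        have "x i \<in> {y i - e<..<y i + e}" using x that by (auto simp: PiE_iff)
        then show ?thesis by auto
      qed
      have "x i \<in> {0..2 * pi}" if "i < n" for i
        using near[OF that] D[OF that] e by auto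
      then have "x \<in> ?A" using x by (auto simp: PiE_iff)
      moreover have "dist (?K x) (?K y) < 1 - s"
        using x near e(2) by (intro e0(2)[rule_format]) (force simp: PiE_iff)+
      ultimately show "x \<in> {x \<in> ?A. s \<le> ?K x}" by (simp add: Ky dist_real_def)
    qed
    then have "emeasure ?M ?V \<le> emeasure ?M {x \<in> ?A. s \<le> ?K x}"
    proof (rule emeasure_mono)
      have "{x \<in> ?A. s \<le> ?K x} = ?A \<inter> {x \<in> space ?M. s \<le> ?K x}"
        using sets.sets_into_space[OF torus_box_sets[of n]] by blast
      then show "{x \<in> ?A. s \<le> ?K x} \<in> sets ?M" by simp
    qed
    moreover have "emeasure ?M ?V > 0"
    proof -
      have "emeasure ?M ?V = (\<Prod>i<n. emeasure lborel {y i - e<..<y i + e})"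
        by (rule emeasure_PiM) simp_all
      also have "\<dots> = (\<Prod>i<n. ennreal (2 * e))"
        using e(1) by (intro prod.cong) simp_all
      also have "\<dots> = ennreal ((2 * e) ^ n)"
        using e(1) by (simp add: ennreal_power)
      finally show ?thesis using e(1) by simp
    qed
    \<comment> \<open>\<open>measure\<close> sends an infinite value to 0, so positivity also
      requires finiteness.\<close>
    moreover have "emeasure ?M {x \<in> ?A. s \<le> ?K x} \<le> emeasure ?M ?A"
      by (rule emeasure_mono) auto
    ultimately show ?thesis
      using emeasure_torus_box_finite[of n]
      by (simp add: measure_def enn2real_positive_iff)
         (blast intro: less_le_trans le_less_trans)
  qed
  ultimately show False by simp
qed

text \<open>A nonzero value at \<open>x\<close> would persist at nearby interior points of the
  box.\<close>

lemma fourier_null_eq_0: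
  assumes cont: "continuous_map (product_topology (\<lambda>_. euclideanreal) {..<n}) euclidean g"
    and null: "fourier_null n g" and x: "x \<in> torus_box n"
  shows "g x = 0"
proof (rule ccontr)
  assume "g x \<noteq> 0"
  then have pos: "norm (g x) > 0" by simp
  have xU: "x \<in> {..<n} \<rightarrow>\<^sub>E UNIV" using x by (auto simp: PiE_iff)
  obtain d where d: "d > 0"
    "\<forall>z \<in> {..<n} \<rightarrow>\<^sub>E UNIV. (\<forall>i\<in>{..<n}. \<bar>z i - x i\<bar> < d) \<longrightarrow> dist (g z) (g x) < norm (g x)"
    by (rule continuous_map_product_real_nbhd[OF finite_lessThan cont xU pos]) (rule that)
  define e where "e = min 1 (d / 2)"
  have e: "0 < e" "e < d" "e \<le> 1" using d(1) by (auto simp: e_def)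
  \<comment> \<open>Clamping each coordinate of \<open>x\<close> to \<open>{e..2 * pi - e}\<close>
    moves it by at most \<open>e\<close>; as \<open>e\<close> is at most 1, this interval is
    nonempty.\<close>
  define z where "z = (\<lambda>i\<in>{..<n}. max e (min (2 * pi - e) (x i)))"
  have z: "z \<in> {..<n} \<rightarrow>\<^sub>E {0<..<2 * pi}"
    using e pi_gt3 by (auto simp: z_def)
  have "\<bar>z i - x i\<bar> < d" if "i \<in> {..<n}" for i
  proof -
    have "0 \<le> x i" "x i \<le> 2 * pi" using x that by (auto simp: PiE_iff)
    then show ?thesis using e that pi_gt3 by (auto simp: z_def max_def min_def)
  qed
  then have "dist (g z) (g x) < norm (g x)" using z by (intro d(2)[rule_format]) (auto simp: PiE_iff)
  with fourier_null_eq_0_interior[OF cont null z] show False by simp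
qed

section \<open>From real coefficients to evenness and back\<close>

text \<open>The coefficients of the left-hand side are the conjugates of those of \<open>q\<close>,
  hence equal to them. The difference of the two sides is thus continuous with vanishing
  coefficients, and uniqueness applies.\<close>

lemma fourier_coeff_real_imp_cnj_reflect:
  assumes cont: "continuous_map (product_topology (\<lambda>_. euclideanreal) {..<n}) euclidean q"
    and real: "\<And>k. k \<in> {..<n} \<rightarrow>\<^sub>E UNIV \<Longrightarrow> fourier_coeff n q k \<in> \<real>"
    and x: "x \<in> torus_box n"
  shows "cnj (q (torus_reflect n x)) = q x"
proof -
  let ?M = "torus_measure n" and ?A = "torus_box n"
  let ?p = "\<lambda>x. cnj (q (torus_reflect n x))"
  have contp: "continuous_map (product_topology (\<lambda>_. euclideanreal) {..<n}) euclidean ?p"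
  proof -
    have "continuous_map euclidean euclidean cnj" by (auto intro!: continuous_intros)
    from continuous_map_compose[OF continuous_map_compose[OF torus_reflect_continuous cont] this]
    show ?thesis by (simp add: o_def)
  qed
  have contd: "continuous_map (product_topology (\<lambda>_. euclideanreal) {..<n}) euclidean (\<lambda>x. ?p x - q x)"
    using contp cont by (rule continuous_map_diff)
  have int: "set_integrable ?M ?A (\<lambda>x. g x * torus_char n k x)"
    if g: "continuous_map (product_topology (\<lambda>_. euclideanreal) {..<n}) euclidean g" for g k
  proof -
    obtain B where "\<And>x. x \<in> ?A \<Longrightarrow> norm (g x) \<le> B"
      by (rule torus_box_bounded_image[OF g]) (rule that)
    moreover have [measurable]: "g \<in> borel_measurable ?M"
      using g by (rule borel_measurable_continuous_map_product)
    ultimately show ?thesis by (intro torus_box_integrable[where B = B]) (auto simp: norm_mult)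
  qed
  have "fourier_null n (\<lambda>x. ?p x - q x)"
    unfolding fourier_null_def
  proof (intro conjI allI)
    show "(\<lambda>x. ?p x - q x) \<in> borel_measurable ?M"
      using contd by (rule borel_measurable_continuous_map_product)
    show "\<exists>B. \<forall>x \<in> ?A. norm (?p x - q x) \<le> B"
      by (rule torus_box_bounded_image[OF contd]) blast
    fix k :: "nat \<Rightarrow> int"
    \<comment> \<open>Reality is assumed only for extensional indices, whereas
      \<open>fourier_null\<close> concerns all; the character sees only the first \<open>n\<close>
      entries.\<close>
    have char: "torus_char n k = torus_char n (restrict k {..<n})"
      by (simp add: torus_char_def fun_eq_iff)
    have "fourier_coeff n q (restrict k {..<n}) \<in> \<real>" by (rule real) auto
    then have "fourier_coeff n q k \<in> \<real>" by (simp add: fourier_coeff_torus_char char[symmetric])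
    then have "fourier_coeff n ?p k = fourier_coeff n q k"
      by (simp add: fourier_coeff_cnj_reflect Reals_cnj_iff)
    then have "(LINT x : ?A | ?M. ?p x * torus_char n k x) = (LINT x : ?A | ?M. q x * torus_char n k x)"
      by (simp add: fourier_coeff_torus_char)
    then show "(LINT x : ?A | ?M. (?p x - q x) * torus_char n k x) = 0"
      using int[OF contp, of k] int[OF cont, of k] by (simp add: left_diff_distrib set_integral_diff)
  qed
  from fourier_null_eq_0[OF contd this x] show ?thesis by simp
qed

theorem propositionA1:
  "\<exists>\<epsilon>::real. 0 < \<epsilon> \<and> \<epsilon> < 1 \<and>
     (\<forall>n\<ge>1. \<forall>(f :: real \<Rightarrow> real) (q :: (nat \<Rightarrow> real) \<Rightarrow> complex).
        C1_on {-1..1} f \<longrightarrow>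
        torus_continuous n q \<longrightarrow>
        (\<forall>k \<in> {..<n} \<rightarrow>\<^sub>E UNIV. fourier_coeff n q k \<in> \<real>) \<longrightarrow>
        torus_sup_norm n q < \<epsilon> \<longrightarrow>
        (\<forall>k \<in> {..<n} \<rightarrow>\<^sub>E UNIV.
           fourier_coeff n (\<lambda>x. of_real (f ((norm (q x))\<^sup>2))) k \<in> \<real>))"
proof (intro exI[of _ "1/2 :: real"] conjI allI impI ballI)
  fix n f q and k :: "nat \<Rightarrow> int"
  assume q: "torus_continuous n q" and real: "\<forall>k \<in> {..<n} \<rightarrow>\<^sub>E UNIV. fourier_coeff n q k \<in> \<real>"
  let ?F = "\<lambda>x. complex_of_real (f ((norm (q x))\<^sup>2))"
  have "norm (q (torus_reflect n x)) = norm (q x)" if "x \<in> torus_box n" for x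
    using fourier_coeff_real_imp_cnj_reflect[of n q x] q real that
    by (metis complex_mod_cnj torus_continuous_def)
  \<comment> \<open>As \<open>?F\<close> is real-valued and even on the box, it agrees there with
    its conjugate reflection, so each of its coefficients equals its own conjugate.\<close>
  then have "fourier_coeff n (\<lambda>x. cnj (?F (torus_reflect n x))) k = fourier_coeff n ?F k"
    unfolding fourier_coeff_torus_char set_lebesgue_integral_def
    by (intro arg_cong2[where f = "(/)"] Bochner_Integration.integral_cong) (auto simp: indicator_def)
  then show "fourier_coeff n ?F k \<in> \<real>"
    by (simp only: fourier_coeff_cnj_reflect[of n ?F k] Reals_cnj_iff)
qed auto

end
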